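(* For every $\varepsilon>0$ the following two asymptotic formulas hold. For every odd integer $n\geq 3$, $$\mathcal F(n)=\frac{\pi}{8}\,n+\frac14\left(\Delta_C(n)-\Delta_C\left(\frac n2\right)\right)+O(n^{\varepsilon}).$$ For every even integer $n\geq 4$, $$\mathcal F(n)=\frac{3\log 2}{4}\,n+2\Delta_H\left(\frac n2\right)-5\Delta_H\left(\frac n4\right)+2\Delta_H\left(\frac n8\right)+O(n^{\varepsilon}).$$ Here the implied constants depend only on $\varepsilon$.
   Context: The Fibonacci sequence is $F_0=0$, $F_1=1$, $F_{j+2}=F_{j+1}+F_j$ for $j\ge 0$. $\{x\}=x-\lfloor x\rfloor$ is the fractional part and $\log$ is the natural logarithm. $\mathbb N=\{1,2,3,\dots\}$. For $n\in\mathbb N$, $$\mathcal F(n)=\sum_{k=1}^{n}\left\{\frac{F_n}{F_k}\right\}.$$ For real $x>0$ let $N_H(x)=\#\{(a,b)\in\mathbb N^2: ab\le x\}$ and $N_C(x)=\#\{(a,b)\in\mathbb Z^2: a^2+b^2\le x\}$. With $\gamma$ Euler's constant, the error terms $\Delta_H$ and $\Delta_C$ are defined by $$N_H(x)=x\log x+(2\gamma-1)x+\Delta_H(x),\qquad N_C(x)=\pi x+\Delta_C(x).$$ *)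

theory Defs
  imports "HOL-Analysis.Analysis" "HOL-Number_Theory.Fib"
begin

definition fib_frac_sum :: "nat \<Rightarrow> real" where
  "fib_frac_sum n = (\<Sum>k=1..n. frac (real (fib n) / real (fib k)))"

definition hyperbola_count :: "real \<Rightarrow> nat" where
  "hyperbola_count x = card {(a :: nat, b :: nat). 1 \<le> a \<and> 1 \<le> b \<and> real (a * b) \<le> x}"

definition circle_count :: "real \<Rightarrow> nat" where
  "circle_count x = card {(a :: int, b :: int). real_of_int (a\<^sup>2 + b\<^sup>2) \<le> x}"

definition hyperbola_error :: "real \<Rightarrow> real" where
  "hyperbola_error x =
     real (hyperbola_count x) - (x * ln x + (2 * euler_mascheroni - 1) * x)"

definition circle_error :: "real \<Rightarrow> real" where
  "circle_error x = real (circle_count x) - pi * x"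

end

theory Submission
  imports Defs "HOL-Number_Theory.Cong"
begin

text \<open>Write \<open>n = q k + r\<close> with \<open>0 \<le> r < k\<close>. Since \<open>F\<^sub>k\<^sub>+\<^sub>1\<close> squares to \<open>(-1)^k\<close> modulo \<open>F\<^sub>k\<close>,
shifting an index by \<open>2 k\<close> changes a Fibonacci number only by the sign \<open>(-1)^k\<close> modulo \<open>F\<^sub>k\<close>.
Hence \<open>F\<^sub>n\<close> is congruent to \<open>\<plusminus> F\<^sub>t\<close>, where \<open>t\<close> is the distance from \<open>n\<close> to the nearest multiple of
\<open>2 k\<close> (\<open>fib_cong_fib_mod_index\<close>). As Fibonacci numbers grow exponentially, \<open>F\<^sub>t / F\<^sub>k\<close> is tiny
unless \<open>k - t\<close> is small, so the fractional part of \<open>F\<^sub>n / F\<^sub>k\<close> is close to 0 or to 1 according to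
the sign. Unless \<open>k\<close> divides \<open>n\<close>, the error is at most a constant times \<open>(2/3)^u\<close> with
\<open>u = k - t\<close>, and then \<open>k\<close> divides \<open>n + u\<close> or \<open>n - u\<close>. The divisors of \<open>n\<close> contribute at most 1
each. Summed over \<open>k\<close>, the errors are dominated by a geometrically weighted sum of divisor counts
of integers below \<open>2 n\<close>, which is \<open>O(n^\<epsilon>)\<close> by the divisor bound (\<open>divisor_count_bound\<close>).

What remains is to count exactly the \<open>k \<le> n\<close> with a negative sign. The sign depends only on the
parities of \<open>n\<close> and \<open>k\<close> and on \<open>q mod 4\<close>.

For odd \<open>n\<close> it is negative when \<open>k\<close> is odd and \<open>q mod 4\<close> is 1 or 2. The indicator of
\<open>q mod 4 \<in> {1, 2}\<close> is the sum of the nonprincipal character modulo 4 over \<open>1, \<dots>, q\<close>, so counting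
over all \<open>k\<close> gives, by Jacobi's two-square theorem (\<open>jacobi_two_squares\<close>), a quarter of the number
of nonzero lattice points in the disc of area \<open>\<pi> n\<close>; the even \<open>k\<close> account for the disc of half
that area. Jacobi's theorem is obtained by Liouville's elementary method: the number of
representations and four times the divisor sum satisfy the same recurrence.

For even \<open>n\<close> the sign is the parity of \<open>q\<close> or of \<open>\<lfloor>q / 2\<rfloor>\<close>, according as \<open>k\<close> is even or odd. A
parity is \<open>\<lfloor>x\<rfloor> - 2 \<lfloor>x / 2\<rfloor>\<close>, so the count is a combination of the sums of \<open>\<lfloor>y / k\<rfloor>\<close> at
\<open>y = n/2, n/4, n/8\<close>, that is, of points under hyperbolas. In the combination \<open>2, -5, 2\<close> the main
terms \<open>x log x\<close> and \<open>x\<close> cancel except for a multiple of \<open>n log 2\<close>.\<close>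

section \<open>Bounds for the number of divisors\<close>

definition divisor_count :: "nat \<Rightarrow> nat" where
  "divisor_count n = card {d. d dvd n}"

lemma divisor_count_mult_le:
  assumes "a > 0" "b > 0"
  shows "divisor_count (a * b) \<le> divisor_count a * divisor_count b"
proof -
  have "{d. d dvd a * b} \<subseteq> (\<lambda>(x, y). x * y) ` ({d. d dvd a} \<times> {d. d dvd b})"
  proof
    fix d assume "d \<in> {d. d dvd a * b}"
    then obtain x y where "d = x * y" "x dvd a" "y dvd b" using division_decomp[of d a b] by auto
    then show "d \<in> (\<lambda>(x, y). x * y) ` ({d. d dvd a} \<times> {d. d dvd b})" by auto
  qed
  then have "card {d. d dvd a * b} \<le> card ((\<lambda>(x, y). x * y) ` ({d. d dvd a} \<times> {d. d dvd b}))"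
    using assms by (intro card_mono) auto
  also have "\<dots> \<le> card ({d. d dvd a} \<times> {d. d dvd b})"
    using assms by (intro card_image_le) auto
  finally show ?thesis by (simp add: divisor_count_def card_cartesian_product)
qed

lemma divisor_count_prime_power_le:
  assumes "prime p"
  shows "divisor_count (p ^ e) \<le> e + 1"
proof -
  have "{d. d dvd p ^ e} = (\<lambda>i. p ^ i) ` {..e}"
    using assms by (auto simp: divides_primepow_nat)
  then show ?thesis using card_image_le[of "{..e}" "\<lambda>i. p ^ i"] by (simp add: divisor_count_def)
qed

lemma divisor_count_prod_le:
  assumes "finite A" "\<And>x. x \<in> A \<Longrightarrow> f x > 0"
  shows "divisor_count (prod f A) \<le> (\<Prod>x\<in>A. divisor_count (f x))"
  using assms
proof (induction A rule: finite_induct)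
  case (insert x A)
  have "divisor_count (f x * prod f A) \<le> divisor_count (f x) * divisor_count (prod f A)"
    using insert.prems by (intro divisor_count_mult_le) (auto intro: prod_pos)
  also have "\<dots> \<le> divisor_count (f x) * (\<Prod>x\<in>A. divisor_count (f x))"
    using insert by (intro mult_left_mono) auto
  finally show ?case using insert by simp
qed (simp add: divisor_count_def)

text \<open>By submultiplicativity it suffices to compare \<open>e + 1\<close> with \<open>p^(\<epsilon> e)\<close> for each prime power
\<open>p^e\<close> exactly dividing \<open>n\<close>. If \<open>p^\<epsilon> \<ge> 2\<close>, then \<open>e + 1 \<le> 2^e\<close> suffices. The other primes lie below
\<open>2^(1/\<epsilon>)\<close>, and each of them costs at most a constant factor by Bernoulli's inequality.\<close>
lemma divisor_count_bound:
  fixes \<epsilon> :: real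
  assumes "\<epsilon> > 0"
  obtains C where "C > 0" "\<And>n. n > 0 \<Longrightarrow> real (divisor_count n) \<le> C * real n powr \<epsilon>"
proof -
  \<comment> \<open>The constant \<open>K\<close> is chosen so that \<open>e + 1 \<le> K (1 + e \<delta>)\<close> for all \<open>e\<close>.\<close>
  define \<delta> where "\<delta> = 2 powr \<epsilon> - 1"
  have \<delta>: "\<delta> > 0" using assms by (simp add: \<delta>_def)
  define K where "K = 1 + 1 / \<delta>"
  have K: "K \<ge> 1" using \<delta> by (simp add: K_def)
  define N where "N = nat \<lceil>2 powr (1 / \<epsilon>)\<rceil>"
  define c where "c p = (if real p powr \<epsilon> < 2 then K else 1)" for p
  have small: "p < N" if "real p powr \<epsilon> < 2" for p
  proof -
    have "real p < 2 powr (1 / \<epsilon>)"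
    proof (rule ccontr)
      assume "\<not> real p < 2 powr (1 / \<epsilon>)"
      then have "(2 powr (1 / \<epsilon>)) powr \<epsilon> \<le> real p powr \<epsilon>"
        using assms by (intro powr_mono2) auto
      then show False using that assms by (simp add: powr_powr)
    qed
    then show ?thesis unfolding N_def by linarith
  qed
  have factor: "real (e + 1) \<le> c p * (real p powr \<epsilon>) ^ e" if "prime p" for p e
  proof (cases "real p powr \<epsilon> < 2")
    case True
    have "2 powr \<epsilon> \<le> real p powr \<epsilon>"
      using assms prime_ge_2_nat[OF that] by (intro powr_mono2) auto
    then have "(1 + \<delta>) ^ e \<le> (real p powr \<epsilon>) ^ e"
      using \<delta> by (intro power_mono) (auto simp: \<delta>_def)
    moreover have "1 + real e * \<delta> \<le> (1 + \<delta>) ^ e"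
      using Bernoulli_inequality[of \<delta> e] \<delta> by simp
    moreover have "real (e + 1) \<le> K * (1 + real e * \<delta>)"
      using \<delta> by (simp add: K_def field_simps)
    ultimately have "real (e + 1) \<le> K * (real p powr \<epsilon>) ^ e"
      using K by (smt (verit) mult_left_mono)
    then show ?thesis using True by (simp add: c_def)
  next
    case False
    have "real (e + 1) \<le> 2 ^ e"
      using Bernoulli_inequality[of 1 e] by simp
    also have "\<dots> \<le> (real p powr \<epsilon>) ^ e" using False by (intro power_mono) auto
    finally show ?thesis using False by (simp add: c_def)
  qed
  have pow: "(real p powr \<epsilon>) ^ e = real (p ^ e) powr \<epsilon>" for p e
    by (induction e) (simp_all add: powr_mult)
  show ?thesis
  proof (rule that[of "K ^ N"])
    fix n :: nat assume n: "n > 0"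
    let ?P = "prime_factors n"
    define m where "m = (\<lambda>p. multiplicity p n)"
    have fact: "n = (\<Prod>p\<in>?P. p ^ m p)"
      unfolding m_def using n by (intro prime_factorization_nat)
    have "divisor_count (\<Prod>p\<in>?P. p ^ m p) \<le> (\<Prod>p\<in>?P. divisor_count (p ^ m p))"
      by (rule divisor_count_prod_le) (auto intro!: prime_gt_0_nat)
    then have "divisor_count n \<le> (\<Prod>p\<in>?P. divisor_count (p ^ m p))"
      by (simp only: fact[symmetric])
    then have "real (divisor_count n) \<le> (\<Prod>p\<in>?P. real (divisor_count (p ^ m p)))"
      unfolding of_nat_prod[symmetric] by (rule of_nat_mono)
    also have "\<dots> \<le> (\<Prod>p\<in>?P. c p * (real p powr \<epsilon>) ^ m p)"
    proof (rule prod_mono, intro conjI)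
      fix p assume "p \<in> ?P"
      then have p: "prime p" by auto
      show "real (divisor_count (p ^ m p)) \<le> c p * (real p powr \<epsilon>) ^ m p"
        using factor[OF p, of "m p"] divisor_count_prime_power_le[OF p, of "m p"]
        by (meson of_nat_mono order_trans)
    qed simp
    also have "\<dots> = (\<Prod>p\<in>?P. c p) * (\<Prod>p\<in>?P. real (p ^ m p) powr \<epsilon>)"
      by (simp only: prod.distrib pow)
    also have "(\<Prod>p\<in>?P. real (p ^ m p) powr \<epsilon>) = real n powr \<epsilon>"
      using prod_powr_distrib[of "\<lambda>p. real (p ^ m p)" ?P \<epsilon>] arg_cong[OF fact, of real]
      by (simp only: of_nat_prod)
    also have "(\<Prod>p\<in>?P. c p) \<le> K ^ N"
    proof -
      have "(\<Prod>p\<in>?P. c p) = K ^ card {p \<in> ?P. real p powr \<epsilon> < 2}"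
        by (simp add: c_def prod.If_cases Int_def)
      also have "\<dots> \<le> K ^ N"
      proof (rule power_increasing[OF _ K])
        have "{p \<in> ?P. real p powr \<epsilon> < 2} \<subseteq> {..<N}" using small by blast
        from card_mono[OF _ this] show "card {p \<in> ?P. real p powr \<epsilon> < 2} \<le> N" by simp
      qed
      finally show ?thesis .
    qed
    finally show "real (divisor_count n) \<le> K ^ N * real n powr \<epsilon>"
      by (simp add: mult_right_mono)
  next
    show "K ^ N > 0" using K by simp
  qed
qed

section \<open>Fibonacci quotients modulo one\<close>

lemma fib_add_cong: "[int (fib (m + k)) = int (fib (k + 1)) * int (fib m)] (mod int (fib k))"
proof (cases m)
  case (Suc l)
  have "fib (m + k) = fib (k + 1) * fib m + fib k * fib l"
    using fib_add[of l k] Suc by (simp add: algebra_simps)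
  then show ?thesis by (simp add: cong_def)
qed (simp add: cong_def)

lemma fib_Suc_square_cong: "[(int (fib (k + 1)))\<^sup>2 = (-1) ^ k] (mod int (fib k))"
proof -
  have "(int (fib (k + 1)))\<^sup>2 - (-1) ^ k = int (fib k) * int (fib (k + 2))"
    using fib_Cassini_int[of k] by (simp add: algebra_simps)
  then show ?thesis by (simp add: cong_iff_dvd_diff)
qed

lemma fib_multiple_add_cong:
  "[int (fib (q * k + r)) = int (fib (k + 1)) ^ q * int (fib r)] (mod int (fib k))"
proof (induction q)
  case (Suc q)
  have "[int (fib (q * k + r + k)) = int (fib (k + 1)) * int (fib (q * k + r))] (mod int (fib k))"
    by (rule fib_add_cong)
  also have "[int (fib (k + 1)) * int (fib (q * k + r))
      = int (fib (k + 1)) * (int (fib (k + 1)) ^ q * int (fib r))] (mod int (fib k))"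
    using Suc.IH by (rule cong_scalar_left)
  finally show ?case by (simp add: algebra_simps)
qed simp

text \<open>Multiplication by \<open>F\<^sub>k\<^sub>+\<^sub>1\<close> shifts the index by \<open>k\<close> modulo \<open>F\<^sub>k\<close>, and its square is \<open>(-1)^k\<close>
by Cassini's identity.\<close>
lemma fib_even_multiple_add_cong:
  "[int (fib (2 * j * k + r)) = (-1) ^ (k * j) * int (fib r)] (mod int (fib k))"
proof -
  have "[int (fib (2 * j * k + r)) = ((int (fib (k + 1)))\<^sup>2) ^ j * int (fib r)] (mod int (fib k))"
    using fib_multiple_add_cong[of "2 * j" k r] by (simp add: power_mult)
  also have "[((int (fib (k + 1)))\<^sup>2) ^ j * int (fib r) = ((-1) ^ k) ^ j * int (fib r)] (mod int (fib k))"
    by (intro cong_scalar_right cong_pow fib_Suc_square_cong)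
  finally show ?thesis by (simp add: power_mult)
qed

text \<open>The sum is \<open>L\<^sub>r F\<^sub>k\<close> with the Lucas number \<open>L\<^sub>r\<close>; divisibility follows because both sides
satisfy the Fibonacci recurrence in \<open>r\<close>.\<close>
lemma fib_add_reflect_dvd:
  "r \<le> k \<Longrightarrow> int (fib k) dvd int (fib (k + r)) + (-1) ^ r * int (fib (k - r))"
proof (induction r rule: fib.induct)
  case 2
  then obtain l where "k = Suc l" by (cases k) auto
  then show ?case by (cases l) auto
next
  case (3 r)
  then obtain l where k: "k = Suc (Suc (r + l))"
    by (metis le_Suc_ex add_Suc)
  have "int (fib (k + Suc (Suc r))) + (-1) ^ Suc (Suc r) * int (fib (k - Suc (Suc r)))
    = (int (fib (k + Suc r)) + (-1) ^ Suc r * int (fib (k - Suc r)))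
      + (int (fib (k + r)) + (-1) ^ r * int (fib (k - r)))"
    by (simp add: k Suc_diff_le algebra_simps)
  then show ?case using 3 by (simp only: dvd_add Suc_leD)
qed simp

text \<open>The index \<open>t\<close>, given by \<open>fib_mod_index\<close>, is the distance from \<open>n\<close> to the nearest multiple of
\<open>2 k\<close>, and the exponent records the sign in \<open>F\<^sub>n \<equiv> (-1)^e F\<^sub>t\<close> modulo \<open>F\<^sub>k\<close>. Its first summand
comes from the shifts by \<open>2 k\<close>; its second one comes from the reflection
\<open>F\<^sub>k\<^sub>+\<^sub>r \<equiv> (-1)^(r + 1) F\<^sub>k\<^sub>-\<^sub>r\<close>, needed when the quotient is odd.\<close>
definition fib_mod_exponent :: "nat \<Rightarrow> nat \<Rightarrow> nat" where
  "fib_mod_exponent n k = k * (n div k div 2) + (if even (n div k) then 0 else n mod k + 1)"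

definition fib_mod_index :: "nat \<Rightarrow> nat \<Rightarrow> nat" where
  "fib_mod_index n k = (if even (n div k) then n mod k else k - n mod k)"

lemma fib_cong_fib_mod_index:
  assumes "k > 0"
  shows "[int (fib n) = (-1) ^ fib_mod_exponent n k * int (fib (fib_mod_index n k))] (mod int (fib k))"
proof (cases "even (n div k)")
  case True
  then obtain j where j: "n div k = 2 * j" by blast
  have "n = 2 * j * k + n mod k" using div_mult_mod_eq[of n k] j by simp
  then show ?thesis using fib_even_multiple_add_cong[of j k "n mod k"] j
    by (simp add: fib_mod_exponent_def fib_mod_index_def)
next
  case False
  then obtain j where j: "n div k = 2 * j + 1" by (auto elim: oddE)
  define r where "r = n mod k"
  have "r \<le> k" using assms by (simp add: r_def less_imp_le)
  have n: "n = 2 * j * k + (k + r)" using div_mult_mod_eq[of n k] j by (simp add: r_def)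
  have "[int (fib n) = (-1) ^ (k * j) * int (fib (k + r))] (mod int (fib k))"
    unfolding n by (rule fib_even_multiple_add_cong)
  also have "[(-1) ^ (k * j) * int (fib (k + r)) = (-1) ^ (k * j) * ((-1) ^ (r + 1) * int (fib (k - r)))] (mod int (fib k))"
    using fib_add_reflect_dvd[OF \<open>r \<le> k\<close>] by (intro cong_scalar_left) (simp add: cong_iff_dvd_diff)
  finally show ?thesis using False j
    by (simp add: fib_mod_exponent_def fib_mod_index_def r_def power_add mult.assoc)
qed

text \<open>The fractional part is \<open>b/m\<close> or \<open>1 - b/m\<close> according to the sign. In the boundary case
\<open>b = m\<close> it is 0 and the bound is 1.\<close>
lemma frac_near_indicator:
  fixes a b m :: int and e :: nat
  assumes "[a = (-1) ^ e * b] (mod m)" "0 < b" "b \<le> m"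
  shows "\<bar>frac (of_int a / of_int m :: real) - of_bool (odd e)\<bar> \<le> of_int b / of_int m"
proof -
  from assms(1) obtain c where "a - (-1) ^ e * b = m * c"
    by (auto simp: cong_iff_dvd_diff elim: dvdE)
  then have a: "a = (-1) ^ e * b + m * c" by simp
  have m: "m > 0" using assms by simp
  have "of_int a / of_int m = (-1) ^ e * (of_int b / of_int m) + (of_int c :: real)"
    using m by (simp add: a field_simps)
  then have frac: "frac (of_int a / of_int m :: real) = frac ((-1) ^ e * (of_int b / of_int m))"
    by (simp add: frac_def)
  define x where "x = (of_int b / of_int m :: real)"
  have x: "0 < x" "x \<le> 1" using assms m by (simp_all add: x_def)
  show ?thesis
  proof (cases "x = 1")
    case True
    then show ?thesis unfolding frac x_def[symmetric] by (cases "even e") (auto simp: frac_def)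
  next
    case False
    then have "frac x = x" using x by (simp add: frac_eq)
    moreover have "x \<notin> \<int>" using \<open>frac x = x\<close> x frac_eq_0_iff[of x] by auto
    ultimately have "frac x = x" "frac (- x) = 1 - x" by (simp_all add: frac_neg)
    then show ?thesis unfolding frac x_def[symmetric] using x by (cases "even e") auto
  qed
qed

lemma fib_mult_le: "fib t * fib (u + 1) \<le> fib (t + u)"
proof (cases t)
  case (Suc s)
  show ?thesis using fib_add[of s u] Suc by (simp add: algebra_simps)
qed simp

text \<open>The base \<open>3/2\<close> is a convenient rational number below the golden ratio: the induction needs
only \<open>(3/2)^2 \<le> 3/2 + 1\<close>.\<close>
lemma fib_Suc_ge_power: "(3 / 2) ^ u \<le> 3 / 2 * real (fib (u + 1))"
proof (induction u rule: fib.induct)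
  case (3 u)
  then show ?case by simp
qed simp_all

lemma fib_ratio_le:
  assumes "t \<le> k" "0 < k"
  shows "real (fib t) / real (fib k) \<le> 3 / 2 * (2 / 3) ^ (k - t)"
proof -
  define u where "u = k - t"
  have "real (fib t) * (3 / 2) ^ u \<le> real (fib t) * (3 / 2 * real (fib (u + 1)))"
    by (intro mult_left_mono fib_Suc_ge_power) simp
  also have "\<dots> = 3 / 2 * real (fib t * fib (u + 1))" by simp
  also have "\<dots> \<le> 3 / 2 * real (fib k)"
    using fib_mult_le[of t u] assms by (intro mult_left_mono of_nat_mono) (simp_all add: u_def)
  finally have "real (fib t) * (3 / 2) ^ u \<le> 3 / 2 * real (fib k)" .
  moreover have "real (fib k) > 0" using fib_neq_0_nat[OF assms(2)] by simp
  moreover have "(2 / 3 :: real) ^ u = 1 / (3 / 2) ^ u" by (simp add: power_divide)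
  ultimately show ?thesis unfolding u_def[symmetric] by (simp add: field_simps)
qed

text \<open>The error for a given \<open>k\<close> is bounded by the term of a single \<open>u\<close>, but this \<open>u\<close> depends on
\<open>k\<close>. With the sum over all \<open>u\<close> the bound is uniform in \<open>k\<close>, and summation over \<open>k\<close> produces
divisor counts.\<close>
lemma fib_frac_near_indicator:
  assumes "k \<in> {1..n}"
  shows "\<bar>frac (real (fib n) / real (fib k)) - of_bool (odd (fib_mod_exponent n k))\<bar>
    \<le> (\<Sum>u<n. 3 / 2 * (2 / 3) ^ u * (of_bool (k dvd n + u) + of_bool (k dvd n - u)))"
    (is "?err \<le> (\<Sum>u<n. ?w u)")
proof -
  define t where "t = fib_mod_index n k"
  have k: "0 < k" "k \<le> n" using assms by auto
  then have mod: "n mod k < k" by simp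
  have t: "t \<le> k" using mod by (simp add: t_def fib_mod_index_def)
  \<comment> \<open>If \<open>t = 0\<close>, then \<open>k\<close> divides \<open>n\<close>; the trivial error bound 1 is then covered by the weight at \<open>u = 0\<close>.\<close>
  define u where "u = (if t = 0 then 0 else k - t)"
  have nonneg: "0 \<le> ?w v" for v by simp
  have dvd: "k dvd n + u \<or> k dvd n - u"
  proof (cases "even (n div k)")
    case True
    have "n + (k - n mod k) = (n div k + 1) * k"
      using div_mult_mod_eq[of n k] mod by (simp only: distrib_right mult_1)
    then have "k dvd n + (k - n mod k)" by (metis dvd_triv_right)
    then show ?thesis using True by (auto simp: u_def t_def fib_mod_index_def)
  next
    case False
    have "n - n mod k = k * (n div k)" by (rule minus_mod_eq_mult_div)
    then have "k dvd n - n mod k" by simp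
    then show ?thesis using False mod by (auto simp: u_def t_def fib_mod_index_def)
  qed
  have "u < n"
  proof (cases "k = n")
    case True
    then show ?thesis using k by (simp add: u_def t_def fib_mod_index_def)
  next
    case False
    then show ?thesis using k by (auto simp: u_def)
  qed
  have "?err \<le> 3 / 2 * (2 / 3) ^ u"
  proof (cases "t = 0")
    case True
    have "frac (real (fib n) / real (fib k)) < 1" "0 \<le> frac (real (fib n) / real (fib k))"
      by (rule frac_lt_1 frac_ge_0)+
    then have "?err \<le> 1" by (cases "odd (fib_mod_exponent n k)") auto
    then show ?thesis using True by (simp add: u_def)
  next
    case False
    have "?err \<le> real (fib t) / real (fib k)"
      using frac_near_indicator[OF fib_cong_fib_mod_index[OF k(1), of n]]
        fib_neq_0_nat[of t] fib_mono[OF t] False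
      by (simp add: t_def)
    also have "\<dots> \<le> 3 / 2 * (2 / 3) ^ u" using fib_ratio_le[OF t k(1)] False by (simp add: u_def)
    finally show ?thesis .
  qed
  also have "\<dots> \<le> ?w u" using dvd by auto
  also have "\<dots> \<le> (\<Sum>u<n. ?w u)"
    using \<open>u < n\<close> nonneg by (intro member_le_sum) auto
  finally show ?thesis .
qed

lemma card_filter_eq_sum:
  "of_nat (card {k \<in> {1..n}. P k}) = (\<Sum>k = 1..n :: nat. of_bool (P k) :: 'a :: semiring_1)"
proof -
  have "{k \<in> {1..n}. P k} = {1..n} \<inter> {k. P k}" by auto
  then show ?thesis by (simp only: sum_of_bool_eq finite_atLeastAtMost)
qed

lemma fib_frac_sum_error_by_divisors:
  "\<bar>(\<Sum>k=1..n. frac (real (fib n) / real (fib k))) - real (card {k \<in> {1..n}. odd (fib_mod_exponent n k)})\<bar>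
    \<le> (\<Sum>u<n. 3 / 2 * (2 / 3) ^ u * (real (divisor_count (n + u)) + real (divisor_count (n - u))))"
proof -
  have card: "real (card {k \<in> {1..n}. odd (fib_mod_exponent n k)})
    = (\<Sum>k=1..n. of_bool (odd (fib_mod_exponent n k)))"
    by (rule card_filter_eq_sum)
  have le: "(\<Sum>k=1..n. of_bool (k dvd m)) \<le> real (divisor_count m)" if "m > 0" for m
  proof -
    have "(\<Sum>k=1..n. of_bool (k dvd m)) = real (card {k \<in> {1..n}. k dvd m})"
      by (rule card_filter_eq_sum[symmetric])
    also have "\<dots> \<le> real (divisor_count m)"
      unfolding divisor_count_def using that by (intro of_nat_mono card_mono) auto
    finally show ?thesis .
  qed
  have "\<bar>(\<Sum>k=1..n. frac (real (fib n) / real (fib k))) - real (card {k \<in> {1..n}. odd (fib_mod_exponent n k)})\<bar>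
    \<le> (\<Sum>k=1..n. \<bar>frac (real (fib n) / real (fib k)) - of_bool (odd (fib_mod_exponent n k))\<bar>)"
    unfolding card sum_subtractf[symmetric] by (rule sum_abs)
  also have "\<dots> \<le> (\<Sum>k=1..n. \<Sum>u<n. 3 / 2 * (2 / 3) ^ u * (of_bool (k dvd n + u) + of_bool (k dvd n - u)))"
    by (intro sum_mono fib_frac_near_indicator)
  also have "\<dots> = (\<Sum>u<n. 3 / 2 * (2 / 3) ^ u * ((\<Sum>k=1..n. of_bool (k dvd n + u)) + (\<Sum>k=1..n. of_bool (k dvd n - u))))"
    by (subst sum.swap) (simp only: sum_distrib_left[symmetric] sum.distrib)
  also have "\<dots> \<le> (\<Sum>u<n. 3 / 2 * (2 / 3) ^ u * (real (divisor_count (n + u)) + real (divisor_count (n - u))))"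
    by (intro sum_mono mult_left_mono add_mono le) auto
  finally show ?thesis .
qed

text \<open>All arguments of the divisor count lie between 1 and \<open>2 n\<close>, and the weights are summable.\<close>
lemma weighted_divisor_sum_bound:
  fixes \<epsilon> :: real
  assumes "\<epsilon> > 0"
  obtains C where "\<And>n. (\<Sum>u<n. 3 / 2 * (2 / 3) ^ u * (real (divisor_count (n + u)) + real (divisor_count (n - u))))
      \<le> C * real n powr \<epsilon>"
proof -
  obtain B where B: "B > 0" "\<And>n. n > 0 \<Longrightarrow> real (divisor_count n) \<le> B * real n powr \<epsilon>"
    using divisor_count_bound[OF assms] by blast
  have geom: "(\<Sum>u<n. (2 / 3 :: real) ^ u) \<le> 3" for n
    by (simp add: sum_gp_strict)
  define D where "D = B * (2 powr \<epsilon> + 1)"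
  have D: "D > 0" using B by (simp add: D_def add_pos_pos)
  have "(\<Sum>u<n. 3 / 2 * (2 / 3) ^ u * (real (divisor_count (n + u)) + real (divisor_count (n - u))))
      \<le> (9 / 2 * D) * real n powr \<epsilon>" for n
  proof -
    have "(\<Sum>u<n. 3 / 2 * (2 / 3) ^ u * (real (divisor_count (n + u)) + real (divisor_count (n - u))))
      \<le> (\<Sum>u<n. 3 / 2 * (2 / 3) ^ u * (D * real n powr \<epsilon>))"
    proof (intro sum_mono mult_left_mono)
      fix u assume "u \<in> {..<n}"
      then have u: "u < n" by simp
      have "real (divisor_count (n + u)) \<le> B * real (n + u) powr \<epsilon>" using u by (intro B) simp
      also have "\<dots> \<le> B * (2 * real n) powr \<epsilon>"
        using u B(1) assms by (intro mult_left_mono powr_mono2) auto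
      also have "\<dots> = B * 2 powr \<epsilon> * real n powr \<epsilon>" by (simp add: powr_mult)
      finally have 1: "real (divisor_count (n + u)) \<le> B * 2 powr \<epsilon> * real n powr \<epsilon>" .
      have "real (divisor_count (n - u)) \<le> B * real (n - u) powr \<epsilon>" using u by (intro B) simp
      also have "\<dots> \<le> B * real n powr \<epsilon>"
        using u B(1) assms by (intro mult_left_mono powr_mono2) auto
      finally show "real (divisor_count (n + u)) + real (divisor_count (n - u)) \<le> D * real n powr \<epsilon>"
        using 1 by (simp add: D_def algebra_simps)
    qed simp
    also have "\<dots> = 3 / 2 * (\<Sum>u<n. (2 / 3) ^ u) * (D * real n powr \<epsilon>)"
      by (simp only: sum_distrib_left sum_distrib_right)
    also have "\<dots> \<le> 3 / 2 * 3 * (D * real n powr \<epsilon>)"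
      using D by (intro mult_right_mono mult_left_mono geom) auto
    finally show ?thesis by simp
  qed
  then show ?thesis by (rule that)
qed

section \<open>Representations as a sum of two squares\<close>

definition chi4 :: "int \<Rightarrow> int" where
  "chi4 x = (if x mod 4 = 1 then 1 else if x mod 4 = 3 then -1 else 0)"

lemma chi4_minus: "chi4 (- x) = - chi4 x"
  unfolding chi4_def by (auto; presburger)

lemma chi4_add_4: "chi4 (x + 4 * y) = chi4 x"
  unfolding chi4_def by simp

lemma chi4_even: "even x \<Longrightarrow> chi4 x = 0"
  unfolding chi4_def by (auto; presburger)

text \<open>Every invertible integral change of variables that preserves the form \<open>i\<^sup>2 + d e\<close> acts on
its solutions; the lemmas below exploit several such maps, and positivity of \<open>d\<close> and \<open>e\<close> decides
where they are defined.\<close>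
definition liouville_set :: "int \<Rightarrow> (int \<times> int \<times> int) set" where
  "liouville_set n = {(i, d, e). i\<^sup>2 + d * e = n \<and> 0 < d \<and> 0 < e}"

lemma abs_le_of_square_le: "\<bar>i\<bar> \<le> n" if "i\<^sup>2 \<le> n" for i n :: int
proof -
  have "\<bar>i\<bar> \<le> i\<^sup>2" using self_le_power[of "\<bar>i\<bar>" 2] by (cases "i = 0") auto
  then show ?thesis using that by linarith
qed

lemma finite_liouville_set: "finite (liouville_set n)"
proof (rule finite_subset)
  show "liouville_set n \<subseteq> {- n..n} \<times> {1..n} \<times> {1..n}"
  proof
    fix x assume "x \<in> liouville_set n"
    then obtain i d e where x: "x = (i, d, e)" and n: "i\<^sup>2 + d * e = n" and pos: "0 < d" "0 < e"
      by (auto simp: liouville_set_def)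
    have "d * 1 \<le> d * e" "1 * e \<le> d * e"
      using pos by (intro mult_left_mono mult_right_mono; simp)+
    then have "i\<^sup>2 \<le> n" "d \<le> n" "e \<le> n" using pos n zero_le_power2[of i] by linarith+
    then show "x \<in> {- n..n} \<times> {1..n} \<times> {1..n}"
      using pos abs_le_of_square_le[of i n] by (auto simp: x)
  qed
qed simp

lemma sum_zero_by_involution:
  fixes f :: "'a \<Rightarrow> int"
  assumes "\<And>x. x \<in> A \<Longrightarrow> g x \<in> A" "\<And>x. x \<in> A \<Longrightarrow> g (g x) = x"
    and "\<And>x. x \<in> A \<Longrightarrow> f (g x) = - f x"
  shows "sum f A = 0"
proof -
  have "sum f A = sum (\<lambda>x. - f x) A"
    by (rule sum.reindex_bij_witness[of _ g g]) (use assms in auto)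
  then show ?thesis by (simp add: sum_negf)
qed

lemma sum_trichotomy:
  fixes u v :: "int \<Rightarrow> int \<Rightarrow> int \<Rightarrow> int" and f :: "int \<times> int \<times> int \<Rightarrow> int"
  assumes "finite S"
  shows "sum f S = sum f {(i, d, e) \<in> S. u i d e < v i d e}
    + (sum f {(i, d, e) \<in> S. v i d e < u i d e} + sum f {(i, d, e) \<in> S. v i d e = u i d e})"
    (is "_ = sum f ?P + (sum f ?N + sum f ?Z)")
proof -
  have fin: "finite ?P" "finite ?N" "finite ?Z"
    using assms by (auto intro: rev_finite_subset)
  have "sum f S = sum f (?P \<union> (?N \<union> ?Z))" by (rule arg_cong[of _ _ "sum f"]) auto
  also have "\<dots> = sum f ?P + sum f (?N \<union> ?Z)"
    using fin by (intro sum.union_disjoint) auto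
  also have "sum f (?N \<union> ?Z) = sum f ?N + sum f ?Z"
    using fin by (intro sum.union_disjoint) auto
  finally show ?thesis .
qed

text \<open>This and \<open>liouville_right\<close> are specializations of Liouville's fundamental identity to the
function \<open>x y \<chi>(z) (-1)^y\<close>, which is odd in \<open>x\<close> and even in \<open>(y, z)\<close>: up to sign, the left one is
its value at \<open>(e - 2 i, d + i, 2 d + 2 i - e)\<close> and the right one its value at \<open>(d + e, i, d - e)\<close>.
The powers of \<open>-1\<close> have been absorbed into the argument of \<open>\<chi>\<close>. The left summand agrees, up to
terms odd in \<open>i\<close>, with the weight \<open>\<chi>(e) (d e - 2 i\<^sup>2)\<close> that occurs in the recurrence.\<close>
definition liouville_left :: "int \<times> int \<times> int \<Rightarrow> int" where
  "liouville_left = (\<lambda>(i, d, e). chi4 e * ((e - 2 * i) * (d + i)))"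
definition liouville_right :: "int \<times> int \<times> int \<Rightarrow> int" where
  "liouville_right = (\<lambda>(i, d, e). (d + e) * i * chi4 (e + 2 * i - d))"

text \<open>The involution exchanges \<open>d\<close> with \<open>d + 2 i - e\<close> and fixes \<open>e\<close> and \<open>d + i\<close>, so it reverses
the sign of the factor \<open>e - 2 i\<close> only.\<close>
lemma liouville_left_neg:
  "sum liouville_left {(i, d, e) \<in> liouville_set n. e < d + 2 * i} = 0"
  by (rule sum_zero_by_involution[where g = "\<lambda>(i, d, e). (e - i, d + 2 * i - e, e)"])
    (auto simp: liouville_set_def liouville_left_def power2_eq_square algebra_simps)

text \<open>The map \<open>(i, d, e) \<mapsto> (d + i, d, e - 2 i - d)\<close> preserves the form \<open>i\<^sup>2 + d e\<close>, and positivity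
of the new third coordinate is exactly the condition that cuts out the left region.\<close>
lemma liouville_left_pos_eq:
  "sum liouville_left {(i, d, e) \<in> liouville_set n. e > d + 2 * i}
   = sum liouville_right {(i, d, e) \<in> liouville_set n. e + 2 * i > d}"
  by (rule sum.reindex_bij_witness[where
        j = "\<lambda>(i, d, e). (d + i, d, e - 2 * i - d)" and i = "\<lambda>(i, d, e). (i - d, d, e + 2 * i - d)"])
    (auto simp: liouville_set_def liouville_left_def liouville_right_def power2_eq_square algebra_simps)

lemma liouville_right_total: "sum liouville_right (liouville_set n) = 0"
proof (rule sum_zero_by_involution[where g = "\<lambda>(i, d, e). (- i, d, e)"])
  fix x assume "x \<in> liouville_set n"
  obtain i d e where x: "x = (i, d, e)" by (cases x) auto
  have "chi4 (e - 2 * i - d) = chi4 (e + 2 * i - d)"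
    using chi4_add_4[of "e - 2 * i - d" i] by (simp add: algebra_simps)
  then show "liouville_right (case x of (i, d, e) \<Rightarrow> (- i, d, e)) = - liouville_right x"
    by (simp add: x liouville_right_def algebra_simps)
qed (auto simp: liouville_set_def)

text \<open>The symmetry \<open>(i, d, e) \<mapsto> (- i, e, d)\<close> preserves the summand and exchanges the regions
\<open>e + 2 i > d\<close> and \<open>e + 2 i < d\<close>, so each carries half of the total, which is zero; the locus
\<open>e + 2 i = d\<close> contributes nothing because the character vanishes at 0.\<close>
lemma liouville_right_pos:
  "sum liouville_right {(i, d, e) \<in> liouville_set n. e + 2 * i > d} = 0" (is "sum _ ?P = 0")
proof -
  let ?N = "{(i, d, e) \<in> liouville_set n. e + 2 * i < d}"
  let ?Z = "{(i, d, e) \<in> liouville_set n. e + 2 * i = d}"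
  have "sum liouville_right ?P = sum liouville_right ?N"
  proof (rule sum.reindex_bij_witness[where
        j = "\<lambda>(i, d, e). (- i, e, d)" and i = "\<lambda>(i, d, e). (- i, e, d)"])
    fix x assume "x \<in> ?P"
    obtain i d e where x: "x = (i, d, e)" by (cases x) auto
    have "chi4 (d - 2 * i - e) = - chi4 (e + 2 * i - d)"
      using chi4_minus[of "e + 2 * i - d"] by (simp add: algebra_simps)
    then show "liouville_right (case x of (i, d, e) \<Rightarrow> (- i, e, d)) = liouville_right x"
      by (simp add: x liouville_right_def algebra_simps)
  qed (auto simp: liouville_set_def algebra_simps)
  moreover have "sum liouville_right ?Z = 0"
    by (rule sum.neutral) (auto simp: liouville_right_def chi4_even)
  moreover have "sum liouville_right (liouville_set n)
      = sum liouville_right ?P + (sum liouville_right ?N + sum liouville_right ?Z)"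
    by (rule sum_trichotomy[OF finite_liouville_set])
  ultimately show ?thesis using liouville_right_total[of n] by simp
qed

text \<open>Passing from \<open>s\<close> to \<open>s + 1\<close> adds twice the unweighted character sum and one new value of the
character, so both sums are evaluated by a simultaneous induction.\<close>
lemma chi4_weighted_sum: "(\<Sum>e = 1..2 * int s - 1. chi4 e * (2 * int s - e)) = int s"
proof -
  have "(\<Sum>e = 1..2 * int s - 1. chi4 e) = (if odd s then 1 else 0)
    \<and> (\<Sum>e = 1..2 * int s - 1. chi4 e * (2 * int s - e)) = int s"
  proof (induction s)
    case (Suc s)
    have set: "{1..2 * int (Suc s) - 1} =
      (if s = 0 then {1} else insert (2 * int s + 1) (insert (2 * int s) {1..2 * int s - 1}))"
      by auto
    have chi: "chi4 (2 * int s + 1) = (if odd s then -1 else 1)"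
      unfolding chi4_def by auto presburger+
    show ?case
    proof (cases "s = 0")
      case True
      then show ?thesis by (simp add: chi4_def)
    next
      case False
      have "(\<Sum>e = 1..2 * int s - 1. chi4 e * (2 * int (Suc s) - e))
        = (\<Sum>e = 1..2 * int s - 1. chi4 e * (2 * int s - e)) + 2 * (\<Sum>e = 1..2 * int s - 1. chi4 e)"
        unfolding sum_distrib_left sum.distrib[symmetric] by (rule sum.cong) (auto simp: algebra_simps)
      then show ?thesis using False Suc.IH chi
        unfolding set by (auto simp: chi4_even split: if_splits)
    qed
  qed simp
  then show ?thesis ..
qed

text \<open>On this locus \<open>i\<^sup>2 + d e = (d + i)\<^sup>2\<close>, so there are solutions only when \<open>n\<close> is a square
\<open>s\<^sup>2\<close>, and then \<open>d + i = s\<close> because \<open>2 (d + i) = d + e\<close> is positive. The triples are parametrized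
by \<open>e \<in> {1..2 s - 1}\<close>.\<close>
lemma liouville_left_zero:
  "sum liouville_left {(i, d, e) \<in> liouville_set n. e = d + 2 * i}
    = (if \<exists>s. n = s\<^sup>2 then n else 0)" (is "sum _ ?Z = _")
proof (cases "\<exists>s. n = s\<^sup>2")
  case False
  have "i\<^sup>2 + d * (d + 2 * i) = (d + i)\<^sup>2" for i d :: int
    by (simp add: power2_eq_square algebra_simps)
  then have "?Z = {}" using False by (auto simp: liouville_set_def)
  then show ?thesis using False by (simp only: sum.empty) simp
next
  case True
  then obtain s0 where "n = s0\<^sup>2" by auto
  then obtain s :: nat where s: "n = (int s)\<^sup>2"
    by (metis nat_0_le abs_ge_zero power2_abs)
  have "sum liouville_left ?Z = (\<Sum>e = 1..2 * int s - 1. int s * (chi4 e * (2 * int s - e)))"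
  proof (rule sum.reindex_bij_witness[where
        j = "\<lambda>(i, d, e). e" and i = "\<lambda>e. (e - int s, 2 * int s - e, e)"])
    fix x assume "x \<in> ?Z"
    then obtain i d e where x: "x = (i, d, e)" and n: "i\<^sup>2 + d * e = n"
      and pos: "0 < d" "0 < e" and e: "e = d + 2 * i"
      by (auto simp: liouville_set_def)
    have "(d + i)\<^sup>2 = (int s)\<^sup>2"
      using n e s by (simp add: power2_eq_square algebra_simps)
    then have di: "d + i = int s" using pos e
      by (simp add: power2_eq_iff)
    then have vals: "i = e - int s" "d = 2 * int s - e" using e by auto
    show "(case case x of (i, d, e) \<Rightarrow> e of e \<Rightarrow> (e - int s, 2 * int s - e, e)) = x"
      using vals x by simp
    show "(case x of (i, d, e) \<Rightarrow> e) \<in> {1..2 * int s - 1}"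
      using vals x pos by simp
    show "int s * (chi4 (case x of (i, d, e) \<Rightarrow> e) * (2 * int s - (case x of (i, d, e) \<Rightarrow> e))) = liouville_left x"
      using vals x by (simp add: liouville_left_def)
  qed (auto simp: liouville_set_def s power2_eq_square algebra_simps)
  also have "\<dots> = int s * int s"
    by (simp only: sum_distrib_left[symmetric] chi4_weighted_sum)
  finally show ?thesis using True s by (simp add: power2_eq_square)
qed

text \<open>Split by the sign of \<open>e - d - 2 i\<close>: the negative part cancels by an involution, the positive
part is carried to the right-hand sum and vanishes there by symmetry, and only the boundary
remains.\<close>
lemma liouville_identity:
  "(\<Sum>(i, d, e) \<in> liouville_set n. chi4 e * (d * e - 2 * i\<^sup>2)) = (if \<exists>s. n = s\<^sup>2 then n else 0)"
proof -
  let ?P = "{(i, d, e) \<in> liouville_set n. e > d + 2 * i}"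
  let ?N = "{(i, d, e) \<in> liouville_set n. e < d + 2 * i}"
  let ?Z = "{(i, d, e) \<in> liouville_set n. e = d + 2 * i}"
  have "sum liouville_left (liouville_set n)
      = sum liouville_left ?P + (sum liouville_left ?N + sum liouville_left ?Z)"
    by (rule sum_trichotomy[OF finite_liouville_set])
  also have "\<dots> = (if \<exists>s. n = s\<^sup>2 then n else 0)"
    unfolding liouville_left_pos_eq liouville_right_pos liouville_left_neg liouville_left_zero by simp
  finally have left: "sum liouville_left (liouville_set n) = (if \<exists>s. n = s\<^sup>2 then n else 0)" .
  have odd: "(\<Sum>(i, d, e) \<in> liouville_set n. chi4 e * (i * (e - 2 * d))) = 0"
    by (rule sum_zero_by_involution[where g = "\<lambda>(i, d, e). (- i, d, e)"])
      (auto simp: liouville_set_def)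
  have "sum liouville_left (liouville_set n)
    = (\<Sum>(i, d, e) \<in> liouville_set n. chi4 e * (d * e - 2 * i\<^sup>2))
    + (\<Sum>(i, d, e) \<in> liouville_set n. chi4 e * (i * (e - 2 * d)))"
    unfolding sum.distrib[symmetric]
    by (rule sum.cong) (auto simp: liouville_left_def power2_eq_square algebra_simps)
  then show ?thesis using left odd by simp
qed

definition sum_chi4_divisors :: "int \<Rightarrow> int" where
  "sum_chi4_divisors m = (\<Sum>e | 0 < e \<and> e dvd m. chi4 e)"

definition two_squares_count :: "int \<Rightarrow> int" where
  "two_squares_count m = int (card {(a :: int, b). a\<^sup>2 + b\<^sup>2 = m})"

lemma finite_two_squares: "finite {(a :: int, b). a\<^sup>2 + b\<^sup>2 = m}"
proof (rule finite_subset)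
  show "{(a :: int, b). a\<^sup>2 + b\<^sup>2 = m} \<subseteq> {- m..m} \<times> {- m..m}"
  proof
    fix x :: "int \<times> int" assume "x \<in> {(a, b). a\<^sup>2 + b\<^sup>2 = m}"
    then obtain a b where x: "x = (a, b)" and ab: "a\<^sup>2 + b\<^sup>2 = m" by auto
    have "\<bar>a\<bar> \<le> m" "\<bar>b\<bar> \<le> m" using ab by (auto intro!: abs_le_of_square_le)
    then show "x \<in> {- m..m} \<times> {- m..m}" using x by auto
  qed
qed simp

lemma finite_squares_below: "finite {i :: int. i\<^sup>2 < n}" "finite {i :: int. i\<^sup>2 \<le> n}"
proof -
  have "{i :: int. i\<^sup>2 \<le> n} \<subseteq> {- n..n}" using abs_le_of_square_le by fastforce
  then show "finite {i :: int. i\<^sup>2 \<le> n}" by (rule finite_subset) simp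
  then show "finite {i :: int. i\<^sup>2 < n}" by (rule rev_finite_subset) auto
qed

text \<open>Summed over all solutions of \<open>i\<^sup>2 + a\<^sup>2 + b\<^sup>2 = n\<close>, the quantity
\<open>n - 3 i\<^sup>2 = a\<^sup>2 + b\<^sup>2 - 2 i\<^sup>2\<close> vanishes because the three variables play the same role.\<close>
lemma two_squares_recurrence:
  "(\<Sum>i | i\<^sup>2 \<le> n. (n - 3 * i\<^sup>2) * two_squares_count (n - i\<^sup>2)) = 0"
proof -
  let ?S = "SIGMA i:{i. i\<^sup>2 \<le> n}. {(a, b). a\<^sup>2 + b\<^sup>2 = n - i\<^sup>2}"
  have mem: "?S = {(i, a, b). i\<^sup>2 + a\<^sup>2 + b\<^sup>2 = n}" (is "_ = ?T")
  proof -
    have "i\<^sup>2 \<le> n" if "i\<^sup>2 + a\<^sup>2 + b\<^sup>2 = n" for i a b :: int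
      using that zero_le_power2[of a] zero_le_power2[of b] by linarith
    then show ?thesis by auto
  qed
  have swap: "(\<Sum>(i, a, b) \<in> ?S. a\<^sup>2) = (\<Sum>(i, a, b) \<in> ?S. i\<^sup>2)"
    unfolding mem by (rule sum.reindex_bij_witness[where i = "\<lambda>(i, a, b). (a, i, b)" and j = "\<lambda>(i, a, b). (a, i, b)"])
      auto
  have swap': "(\<Sum>(i, a, b) \<in> ?S. b\<^sup>2) = (\<Sum>(i, a, b) \<in> ?S. i\<^sup>2)"
    unfolding mem by (rule sum.reindex_bij_witness[where i = "\<lambda>(i, a, b). (b, a, i)" and j = "\<lambda>(i, a, b). (b, a, i)"])
      auto
  have "(\<Sum>i | i\<^sup>2 \<le> n. (n - 3 * i\<^sup>2) * two_squares_count (n - i\<^sup>2))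
    = (\<Sum>i | i\<^sup>2 \<le> n. \<Sum>(a, b) \<in> {(a, b). a\<^sup>2 + b\<^sup>2 = n - i\<^sup>2}. n - 3 * i\<^sup>2)"
    by (simp add: two_squares_count_def mult.commute case_prod_unfold)
  also have "\<dots> = (\<Sum>(i, a, b) \<in> ?S. n - 3 * i\<^sup>2)"
    by (subst sum.Sigma) (use finite_two_squares finite_squares_below in \<open>auto simp: case_prod_unfold\<close>)
  also have "\<dots> = (\<Sum>(i, a, b) \<in> ?S. a\<^sup>2 + b\<^sup>2 - 2 * i\<^sup>2)"
    by (rule sum.cong) auto
  also have "\<dots> = (\<Sum>(i, a, b) \<in> ?S. a\<^sup>2) + (\<Sum>(i, a, b) \<in> ?S. b\<^sup>2) - 2 * (\<Sum>(i, a, b) \<in> ?S. i\<^sup>2)"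
    by (simp add: case_prod_unfold sum.distrib sum_subtractf sum_distrib_left)
  finally show ?thesis using swap swap' by simp
qed

lemma sum_chi4_divisors_recurrence:
  "(\<Sum>i | i\<^sup>2 < n. (n - 3 * i\<^sup>2) * sum_chi4_divisors (n - i\<^sup>2)) = (if \<exists>s. n = s\<^sup>2 then n else 0)"
proof -
  let ?S = "SIGMA i:{i. i\<^sup>2 < n}. {e. 0 < e \<and> e dvd n - i\<^sup>2}"
  have "(\<Sum>i | i\<^sup>2 < n. (n - 3 * i\<^sup>2) * sum_chi4_divisors (n - i\<^sup>2))
    = (\<Sum>i | i\<^sup>2 < n. \<Sum>e | 0 < e \<and> e dvd n - i\<^sup>2. chi4 e * (n - 3 * i\<^sup>2))"
    by (simp add: sum_chi4_divisors_def sum_distrib_left mult.commute)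
  also have "\<dots> = (\<Sum>(i, e) \<in> ?S. chi4 e * (n - 3 * i\<^sup>2))"
  proof (rule sum.Sigma)
    show "\<forall>i\<in>{i. i\<^sup>2 < n}. finite {e. 0 < e \<and> e dvd n - i\<^sup>2}"
    proof
      fix i assume "i \<in> {i. i\<^sup>2 < n}"
      then show "finite {e. 0 < e \<and> e dvd n - i\<^sup>2}"
        by (intro finite_subset[of "{e. 0 < e \<and> e dvd n - i\<^sup>2}" "{1..n - i\<^sup>2}"]) (auto simp: zdvd_imp_le)
    qed
  qed (rule finite_squares_below)
  also have "\<dots> = (\<Sum>(i, d, e) \<in> liouville_set n. chi4 e * (d * e - 2 * i\<^sup>2))"
  proof (rule sum.reindex_bij_witness[where i = "\<lambda>(i, d, e). (i, e)" and j = "\<lambda>(i, e). (i, (n - i\<^sup>2) div e, e)"])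
    fix x assume "x \<in> ?S"
    then obtain i e where x: "x = (i, e)" and i: "i\<^sup>2 < n" and e: "0 < e" "e dvd n - i\<^sup>2" by auto
    then obtain d where d: "n - i\<^sup>2 = e * d" by (elim dvdE)
    then have "0 < d" using i e by (metis diff_gt_0_iff_gt zero_less_mult_pos)
    then show "(case x of (i, e) \<Rightarrow> (i, (n - i\<^sup>2) div e, e)) \<in> liouville_set n"
      using x d e by (auto simp: liouville_set_def algebra_simps)
    show "(case case x of (i, e) \<Rightarrow> (i, (n - i\<^sup>2) div e, e) of
        (i, d, e) \<Rightarrow> chi4 e * (d * e - 2 * i\<^sup>2)) = (case x of (i, e) \<Rightarrow> chi4 e * (n - 3 * i\<^sup>2))"
      using x d e by (simp add: algebra_simps)
  qed (auto simp: liouville_set_def)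
  also note liouville_identity
  finally show ?thesis .
qed

lemma two_squares_count_0: "two_squares_count 0 = 1"
proof -
  have "{(a :: int, b). a\<^sup>2 + b\<^sup>2 = 0} = {(0, 0)}"
    by (auto simp: sum_power2_eq_zero_iff)
  then show ?thesis by (simp add: two_squares_count_def)
qed

lemma card_square_roots: "n > 0 \<Longrightarrow> int (card {i :: int. i\<^sup>2 = n}) = (if \<exists>s. n = s\<^sup>2 then 2 else 0)"
proof (cases "\<exists>s. n = s\<^sup>2")
  case True
  assume "n > 0"
  from True obtain s where s: "n = s\<^sup>2" by auto
  then have "s \<noteq> 0" "{i :: int. i\<^sup>2 = n} = {s, - s}" using \<open>n > 0\<close> by (auto simp: power2_eq_iff)
  then show ?thesis using True by auto
next
  case False
  then have "{i :: int. i\<^sup>2 = n} = {}" by auto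
  then show ?thesis using False by auto
qed

text \<open>Both sides satisfy a recurrence that expresses the value at \<open>n\<close> through the values at
\<open>n - i\<^sup>2\<close> with \<open>i \<noteq> 0\<close>. The recurrence for the count of representations contains in addition the
terms with \<open>i\<^sup>2 = n\<close>. When \<open>n\<close> is a square there are two of them, each equal to \<open>-2 n\<close>, and
together they match four times the inhomogeneous term \<open>n\<close> in the recurrence for the divisor sum.\<close>
theorem jacobi_two_squares:
  assumes "n > 0"
  shows "two_squares_count n = 4 * sum_chi4_divisors n"
  using assms
proof (induction "nat n" arbitrary: n rule: less_induct)
  case less
  define R where "R = {i :: int. i\<^sup>2 < n \<and> i \<noteq> 0}"
  have finR: "finite R" unfolding R_def by (rule rev_finite_subset[OF finite_squares_below(1)]) auto
  have IH: "two_squares_count (n - i\<^sup>2) = 4 * sum_chi4_divisors (n - i\<^sup>2)" if "i \<in> R" for i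
    using that less.prems by (intro less.hyps) (auto simp: R_def)
  have le: "{i. i\<^sup>2 \<le> n} = insert 0 (R \<union> {i. i\<^sup>2 = n})"
    and lt: "{i. i\<^sup>2 < n} = insert 0 R" using less.prems by (auto simp: R_def)
  have finQ: "finite {i :: int. i\<^sup>2 = n}" by (rule rev_finite_subset[OF finite_squares_below(2)[of n]]) auto
  have "0 = (\<Sum>i \<in> insert 0 (R \<union> {i. i\<^sup>2 = n}). (n - 3 * i\<^sup>2) * two_squares_count (n - i\<^sup>2))"
    using two_squares_recurrence[of n] unfolding le by simp
  also have "\<dots> = n * two_squares_count n
    + ((\<Sum>i \<in> R. (n - 3 * i\<^sup>2) * two_squares_count (n - i\<^sup>2))
      + (\<Sum>i | i\<^sup>2 = n. (n - 3 * i\<^sup>2) * two_squares_count (n - i\<^sup>2)))"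
    using less.prems finR finQ
    by (subst sum.insert; (subst sum.union_disjoint)?) (auto simp: R_def)
  also have "(\<Sum>i | i\<^sup>2 = n. (n - 3 * i\<^sup>2) * two_squares_count (n - i\<^sup>2))
      = - 2 * n * int (card {i :: int. i\<^sup>2 = n})"
    by (simp add: two_squares_count_0)
  also have "(\<Sum>i \<in> R. (n - 3 * i\<^sup>2) * two_squares_count (n - i\<^sup>2))
    = 4 * (\<Sum>i \<in> R. (n - 3 * i\<^sup>2) * sum_chi4_divisors (n - i\<^sup>2))"
    unfolding sum_distrib_left by (rule sum.cong) (auto simp: IH)
  finally have 1: "n * two_squares_count n + 4 * (\<Sum>i \<in> R. (n - 3 * i\<^sup>2) * sum_chi4_divisors (n - i\<^sup>2))
     = 2 * n * (if \<exists>s. n = s\<^sup>2 then 2 else 0)"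
    using less.prems by (simp only: card_square_roots)
  have "(if \<exists>s. n = s\<^sup>2 then n else 0) = n * sum_chi4_divisors n
    + (\<Sum>i \<in> R. (n - 3 * i\<^sup>2) * sum_chi4_divisors (n - i\<^sup>2))"
    unfolding sum_chi4_divisors_recurrence[symmetric] lt
    using finR by (subst sum.insert) (auto simp: R_def)
  with 1 have "n * two_squares_count n = 4 * (n * sum_chi4_divisors n)"
    by (cases "\<exists>s. n = s\<^sup>2") (simp_all only: if_True if_False; linarith)+
  then show ?case using less.prems by simp
qed

section \<open>Lattice point counts\<close>

lemma of_nat_le_iff_le_nat_floor: "x \<ge> 0 \<Longrightarrow> real c \<le> x \<longleftrightarrow> c \<le> nat \<lfloor>x\<rfloor>"
  by (metis le_nat_floor of_nat_floor of_nat_mono order_trans)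

lemma nat_floor_of_nat_divide: "nat \<lfloor>real n / real m\<rfloor> = n div m"
  by (simp add: floor_divide_of_nat_eq)

lemma hyperbola_count_eq_sum:
  assumes "x \<ge> 0" and N: "N = nat \<lfloor>x\<rfloor>"
  shows "hyperbola_count x = (\<Sum>k=1..N. N div k)"
proof -
  have "{(a :: nat, b :: nat). 1 \<le> a \<and> 1 \<le> b \<and> real (a * b) \<le> x} = (SIGMA k:{1..N}. {1..N div k})"
  proof -
    have "1 \<le> a \<and> 1 \<le> b \<and> real (a * b) \<le> x \<longleftrightarrow> a \<in> {1..N} \<and> b \<in> {1..N div a}" for a b
    proof -
      have "real (a * b) \<le> x \<longleftrightarrow> b * a \<le> N"
        unfolding N of_nat_le_iff_le_nat_floor[OF assms(1)] by (simp add: mult.commute)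
      moreover have "a \<le> N" if "1 \<le> a" "1 \<le> b" "b * a \<le> N"
        using mult_le_mono1[OF that(2), of a] that(3) by linarith
      ultimately show ?thesis by (auto simp: less_eq_div_iff_mult_less_eq)
    qed
    then show ?thesis by auto
  qed
  then show ?thesis by (simp add: hyperbola_count_def)
qed

lemma sum_split_odd_even:
  fixes f :: "nat \<Rightarrow> 'a :: comm_monoid_add"
  shows "(\<Sum>k=1..n. f k) = (\<Sum>k | k \<in> {1..n} \<and> odd k. f k) + (\<Sum>k=1..n div 2. f (2 * k))"
proof -
  have "(\<Sum>k=1..n. f k) = (\<Sum>k | k \<in> {1..n} \<and> odd k. f k) + (\<Sum>k | k \<in> {1..n} \<and> even k. f k)"
    by (subst sum.union_disjoint[symmetric]) (auto intro!: sum.cong)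
  also have "(\<Sum>k | k \<in> {1..n} \<and> even k. f k) = (\<Sum>k=1..n div 2. f (2 * k))"
    by (rule sum.reindex_bij_witness[where i = "\<lambda>k. 2 * k" and j = "\<lambda>k. k div 2"]) auto
  finally show ?thesis .
qed

text \<open>Both sides sum \<open>f d\<close> over the pairs \<open>(k, d)\<close> with \<open>k d \<le> N\<close>.\<close>
lemma sum_sum_divisors:
  fixes f :: "nat \<Rightarrow> 'a :: comm_monoid_add"
  shows "(\<Sum>m=1..N. \<Sum>d | d dvd m. f d) = (\<Sum>k=1..N. \<Sum>d=1..N div k. f d)"
proof -
  have "(\<Sum>m=1..N. \<Sum>d | d dvd m. f d) = (\<Sum>(m, d) \<in> (SIGMA m:{1..N}. {d. d dvd m}). f d)"
    by (rule sum.Sigma) auto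
  also have "\<dots> = (\<Sum>(k, d) \<in> (SIGMA k:{1..N}. {1..N div k}). f d)"
  proof (rule sum.reindex_bij_witness[where i = "\<lambda>(k, d). (k * d, d)" and j = "\<lambda>(m, d). (m div d, d)"])
    fix x assume "x \<in> (SIGMA m:{1..N}. {d. d dvd m})"
    then obtain m d where x: "x = (m, d)" "1 \<le> m" "m \<le> N" "d dvd m" by auto
    then obtain k where m: "m = d * k" by blast
    then have pos: "0 < d" "0 < k" using x by auto
    have "d \<le> N div k" using x m pos by (simp add: less_eq_div_iff_mult_less_eq)
    moreover have "k \<le> N" using x m pos by (meson dvd_imp_le dvd_triv_right le_trans less_le_trans zero_less_one)
    ultimately show "(case x of (m, d) \<Rightarrow> (m div d, d)) \<in> (SIGMA k:{1..N}. {1..N div k})"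
      using x m pos by auto
  qed (auto simp: less_eq_div_iff_mult_less_eq mult.commute)
  also have "\<dots> = (\<Sum>k=1..N. \<Sum>d=1..N div k. f d)"
    by (rule sum.Sigma[symmetric]) auto
  finally show ?thesis .
qed

lemma sum_chi4_divisors_int:
  assumes "m > 0"
  shows "sum_chi4_divisors (int m) = (\<Sum>d | d dvd m. chi4 (int d))"
  unfolding sum_chi4_divisors_def
  by (rule sum.reindex_bij_witness[where i = int and j = nat])
    (use assms in \<open>auto simp: nat_dvd_iff intro: dvd_pos_nat\<close>)

lemma sum_chi4: "(\<Sum>d=1..q. chi4 (int d)) = of_bool (q mod 4 \<in> {1, 2})"
proof (induction q)
  case (Suc q)
  have "chi4 (int (Suc q)) = of_bool (Suc q mod 4 \<in> {1, 2}) - of_bool (q mod 4 \<in> {1, 2})"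
  proof -
    have "int (Suc q) mod 4 = int (Suc q mod 4)" by (simp only: zmod_int of_nat_numeral)
    moreover have "q mod 4 = 0 \<or> q mod 4 = 1 \<or> q mod 4 = 2 \<or> q mod 4 = 3" by presburger
    ultimately show ?thesis unfolding chi4_def by (elim disjE) (simp_all add: mod_Suc)
  qed
  then show ?case using Suc by simp
qed simp

text \<open>This is the sum of the character modulo 4 over the divisors of all positive integers up to
\<open>N\<close>: the summand is the character sum over \<open>1, \<dots>, N div k\<close>.\<close>
definition chi4_hyperbola_sum :: "nat \<Rightarrow> nat" where
  "chi4_hyperbola_sum N = (\<Sum>k=1..N. of_bool ((N div k) mod 4 \<in> {1, 2}))"

lemma circle_count_eq_sum:
  assumes "x \<ge> 0" and N: "N = nat \<lfloor>x\<rfloor>"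
  shows "circle_count x = 1 + 4 * chi4_hyperbola_sum N"
proof -
  have disc: "{(a :: int, b :: int). real_of_int (a\<^sup>2 + b\<^sup>2) \<le> x} = (\<Union>m\<in>{0..N}. {(a, b). a\<^sup>2 + b\<^sup>2 = int m})"
  proof -
    have "real_of_int (a\<^sup>2 + b\<^sup>2) \<le> x \<longleftrightarrow> (\<exists>m\<in>{0..N}. a\<^sup>2 + b\<^sup>2 = int m)" for a b
    proof -
      obtain c where c: "a\<^sup>2 + b\<^sup>2 = int c"
        by (metis nonneg_int_cases sum_power2_ge_zero)
      then have "real_of_int (a\<^sup>2 + b\<^sup>2) = real c" by simp
      then show ?thesis using of_nat_le_iff_le_nat_floor[OF assms(1), of c] c by (simp add: N)
    qed
    then show ?thesis by auto
  qed
  have "circle_count x = (\<Sum>m\<in>{0..N}. card {(a :: int, b). a\<^sup>2 + b\<^sup>2 = int m})"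
    unfolding circle_count_def disc
    by (subst card_UN_disjoint) (use finite_two_squares in \<open>auto simp: case_prod_unfold\<close>)
  then have "int (circle_count x) = (\<Sum>m=0..N. two_squares_count (int m))"
    by (simp add: two_squares_count_def)
  also have "\<dots> = 1 + (\<Sum>m=1..N. two_squares_count (int m))"
    by (simp add: sum.atLeast_Suc_atMost two_squares_count_0)
  also have "(\<Sum>m=1..N. two_squares_count (int m)) = (\<Sum>m=1..N. 4 * (\<Sum>d | d dvd m. chi4 (int d)))"
    by (rule sum.cong) (auto simp: jacobi_two_squares sum_chi4_divisors_int)
  also have "\<dots> = 4 * (\<Sum>k=1..N. \<Sum>d=1..N div k. chi4 (int d))"
    by (simp only: sum_distrib_left[symmetric] sum_sum_divisors)
  also have "\<dots> = 4 * int (chi4_hyperbola_sum N)"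
    by (simp only: sum_chi4 chi4_hyperbola_sum_def of_nat_sum of_nat_of_bool)
  finally show ?thesis by linarith
qed

text \<open>For odd \<open>n\<close> the parity of \<open>n mod k\<close> is determined by those of \<open>k\<close> and the quotient, so the
remainder disappears from the sign.\<close>
lemma odd_fib_mod_exponent_odd:
  assumes "odd n"
  shows "odd (fib_mod_exponent n k) \<longleftrightarrow> odd k \<and> (n div k) mod 4 \<in> {1, 2}"
proof -
  define q r where "q = n div k" and "r = n mod k"
  have par: "even (q div 2) \<longleftrightarrow> q mod 4 = 0 \<or> q mod 4 = 1" and par': "even q \<longleftrightarrow> q mod 4 = 0 \<or> q mod 4 = 2"
    by presburger+
  have lt: "q mod 4 = 0 \<or> q mod 4 = 1 \<or> q mod 4 = 2 \<or> q mod 4 = 3" by presburger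
  have "odd (q * k + r)" using assms by (simp add: q_def r_def)
  then show ?thesis using lt
    unfolding fib_mod_exponent_def q_def[symmetric] r_def[symmetric]
    by (elim disjE) (simp_all add: par par')
qed

lemma odd_fib_mod_exponent_even:
  assumes "even n"
  shows "odd (fib_mod_exponent n k) \<longleftrightarrow> (if even k then odd (n div k) else odd (n div k div 2))"
proof -
  define q r where "q = n div k" and "r = n mod k"
  have "even (q * k + r)" using assms by (simp add: q_def r_def)
  then show ?thesis
    unfolding fib_mod_exponent_def q_def[symmetric] r_def[symmetric] by auto
qed

text \<open>Over all \<open>k\<close> the condition on \<open>n div k\<close> counts the disc of area \<open>\<pi> n\<close>; the even values \<open>2 k\<close>
contribute the same count for \<open>n div 2\<close>.\<close>
lemma card_odd_exponent_odd:
  assumes "odd n"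
  shows "real (card {k \<in> {1..n}. odd (fib_mod_exponent n k)})
    = (real (circle_count (real n)) - real (circle_count (real n / 2))) / 4"
proof -
  have half: "circle_count (real n / 2) = 1 + 4 * chi4_hyperbola_sum (n div 2)"
    by (rule circle_count_eq_sum) (use nat_floor_of_nat_divide[of n 2] in auto)
  have full: "circle_count (real n) = 1 + 4 * chi4_hyperbola_sum n"
    by (rule circle_count_eq_sum) auto
  let ?f = "\<lambda>k. of_bool ((n div k) mod 4 \<in> {1, 2}) :: nat"
  have "chi4_hyperbola_sum n = (\<Sum>k | k \<in> {1..n} \<and> odd k. ?f k) + (\<Sum>k=1..n div 2. ?f (2 * k))"
    unfolding chi4_hyperbola_sum_def by (rule sum_split_odd_even)
  also have "(\<Sum>k=1..n div 2. ?f (2 * k)) = chi4_hyperbola_sum (n div 2)"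
    by (simp only: chi4_hyperbola_sum_def div_mult2_eq)
  also have "(\<Sum>k | k \<in> {1..n} \<and> odd k. ?f k) = card {k \<in> {1..n}. odd (fib_mod_exponent n k)}"
    unfolding card_filter_eq_sum[where 'a = nat, simplified of_nat_id]
    by (rule sum.mono_neutral_cong_left) (auto simp: odd_fib_mod_exponent_odd[OF assms])
  finally show ?thesis by (simp add: half full)
qed

text \<open>The odd \<open>k\<close> contribute the parity of \<open>n div (2 k)\<close>, and the even numbers \<open>2 k\<close> contribute
the parity of the same quotient. So the count is the sum of the function \<open>\<lfloor>n / 2 k\<rfloor> - 2 \<lfloor>n / 4 k\<rfloor>\<close>
over the odd \<open>k \<le> n\<close> plus its sum over all \<open>k \<le> n / 2\<close>.\<close>
lemma card_odd_exponent_even: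
  assumes "even n"
  shows "real (card {k \<in> {1..n}. odd (fib_mod_exponent n k)})
    = 2 * real (hyperbola_count (real n / 2)) - 5 * real (hyperbola_count (real n / 4))
      + 2 * real (hyperbola_count (real n / 8))"
proof -
  define D where "D N = (\<Sum>k=1..N. int (N div k))" for N :: nat
  have "int (hyperbola_count (real n / real m)) = D (n div m)" for m
    by (simp add: D_def hyperbola_count_eq_sum[of _ "n div m"] nat_floor_of_nat_divide)
  from this[of 2] this[of 4] this[of 8] have D:
    "int (hyperbola_count (real n / 2)) = D (n div 2)"
    "int (hyperbola_count (real n / 4)) = D (n div 4)"
    "int (hyperbola_count (real n / 8)) = D (n div 8)"
    by (simp_all only: of_nat_numeral)
  have ext: "(\<Sum>k=1..M. int (N div k)) = D N" if "N \<le> M" for M N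
    unfolding D_def using that by (intro sum.mono_neutral_right) auto
  let ?g = "\<lambda>k. int (n div 2 div k) - 2 * int (n div 4 div k)"
  have all: "(\<Sum>k=1..M. ?g k) = D (n div 2) - 2 * D (n div 4)" if "n div 2 \<le> M" for M
    using ext[of "n div 2" M] ext[of "n div 4" M] that
    by (simp only: sum_subtractf sum_distrib_left[symmetric])
  have dbl: "?g (2 * k) = int (n div 4 div k) - 2 * int (n div 8 div k)" for k
    by (simp add: div_mult2_eq[symmetric])
  have evens: "(\<Sum>k=1..n div 2. ?g (2 * k)) = D (n div 4) - 2 * D (n div 8)"
    using ext[of "n div 4" "n div 2"] ext[of "n div 8" "n div 2"]
    by (simp only: dbl sum_subtractf sum_distrib_left[symmetric])
  have bit: "of_bool (odd q) = int q - 2 * int (q div 2)" for q :: nat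
    by (simp add: of_bool_def) presburger
  have "int (card {k \<in> {1..n}. odd (fib_mod_exponent n k)})
      = (\<Sum>k=1..n. of_bool (odd (fib_mod_exponent n k)))"
    by (rule card_filter_eq_sum)
  also have "\<dots> = (\<Sum>k | k \<in> {1..n} \<and> odd k. of_bool (odd (fib_mod_exponent n k)))
      + (\<Sum>k=1..n div 2. of_bool (odd (fib_mod_exponent n (2 * k))))"
    by (rule sum_split_odd_even)
  also have "(\<Sum>k | k \<in> {1..n} \<and> odd k. of_bool (odd (fib_mod_exponent n k)))
      = (\<Sum>k | k \<in> {1..n} \<and> odd k. ?g k)"
  proof (rule sum.cong)
    fix k assume "k \<in> {k. k \<in> {1..n} \<and> odd k}"
    then show "of_bool (odd (fib_mod_exponent n k)) = ?g k"
      using bit[of "n div k div 2"]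
      by (simp add: odd_fib_mod_exponent_even[OF assms] div_mult2_eq[symmetric] mult.commute)
  qed simp
  also have "\<dots> = (\<Sum>k=1..n. ?g k) - (\<Sum>k=1..n div 2. ?g (2 * k))"
    using sum_split_odd_even[of ?g n] by simp
  also have "(\<Sum>k=1..n div 2. of_bool (odd (fib_mod_exponent n (2 * k)))) = (\<Sum>k=1..n div 2. ?g k)"
  proof (rule sum.cong)
    fix k assume "k \<in> {1..n div 2}"
    show "of_bool (odd (fib_mod_exponent n (2 * k))) = ?g k"
      using bit[of "n div (2 * k)"]
      by (simp add: odd_fib_mod_exponent_even[OF assms] div_mult2_eq[symmetric] mult.commute)
  qed simp
  finally have "int (card {k \<in> {1..n}. odd (fib_mod_exponent n k)})
    = 2 * D (n div 2) - 5 * D (n div 4) + 2 * D (n div 8)"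
    using all[of n] all[of "n div 2"] evens by simp
  then have "real_of_int (int (card {k \<in> {1..n}. odd (fib_mod_exponent n k)}))
    = real_of_int (2 * int (hyperbola_count (real n / 2)) - 5 * int (hyperbola_count (real n / 4))
      + 2 * int (hyperbola_count (real n / 8)))"
    unfolding D by (rule arg_cong)
  then show ?thesis by simp
qed

lemma odd_main_term:
  "(real (circle_count (real n)) - real (circle_count (real n / 2))) / 4 =
    pi / 8 * real n + 1 / 4 * (circle_error (real n) - circle_error (real n / 2))"
  by (simp add: circle_error_def field_simps)

text \<open>The coefficients satisfy \<open>2/2 - 5/4 + 2/8 = 0\<close>, which cancels both \<open>n log n\<close> and the
multiples of \<open>n\<close> involving Euler's constant; only the shifts of the logarithm by \<open>log 2\<close>,
\<open>2 log 2\<close> and \<open>3 log 2\<close> survive.\<close>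
lemma even_main_term:
  assumes "n > 0"
  shows "2 * real (hyperbola_count (real n / 2)) - 5 * real (hyperbola_count (real n / 4))
      + 2 * real (hyperbola_count (real n / 8)) =
    3 * ln 2 / 4 * real n + 2 * hyperbola_error (real n / 2) - 5 * hyperbola_error (real n / 4)
      + 2 * hyperbola_error (real n / 8)"
proof -
  have ln2: "ln (real n / 2) = ln (real n) - ln 2" using assms by (simp add: ln_div)
  have "ln (4 :: real) = 2 * ln 2" "ln (8 :: real) = 3 * ln 2"
    using ln_realpow[of 2 2] ln_realpow[of 2 3] by simp_all
  then have ln48: "ln (real n / 4) = ln (real n) - 2 * ln 2" "ln (real n / 8) = ln (real n) - 3 * ln 2"
    using assms by (simp_all add: ln_div)
  show ?thesis unfolding hyperbola_error_def ln2 ln48 by (simp add: field_simps)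
qed

section \<open>The asymptotic formulas\<close>

theorem theorem1p1:
  fixes \<epsilon> :: real
  assumes "\<epsilon> > 0"
  shows "(\<exists>C::real. \<forall>n::nat. odd n \<and> n \<ge> 3 \<longrightarrow>
            \<bar>fib_frac_sum n
               - (pi / 8 * real n
                  + 1 / 4 * (circle_error (real n) - circle_error (real n / 2)))\<bar>
            \<le> C * real n powr \<epsilon>)
       \<and> (\<exists>C::real. \<forall>n::nat. even n \<and> n \<ge> 4 \<longrightarrow>
            \<bar>fib_frac_sum n
               - (3 * ln 2 / 4 * real n
                  + 2 * hyperbola_error (real n / 2)
                  - 5 * hyperbola_error (real n / 4)
                  + 2 * hyperbola_error (real n / 8))\<bar>
            \<le> C * real n powr \<epsilon>)"
proof -
  obtain C where C: "\<And>n. (\<Sum>u<n. 3 / 2 * (2 / 3) ^ u *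
      (real (divisor_count (n + u)) + real (divisor_count (n - u)))) \<le> C * real n powr \<epsilon>"
    using weighted_divisor_sum_bound[OF assms] by blast
  have err: "\<bar>fib_frac_sum n - real (card {k \<in> {1..n}. odd (fib_mod_exponent n k)})\<bar>
      \<le> C * real n powr \<epsilon>" for n
    unfolding fib_frac_sum_def using fib_frac_sum_error_by_divisors C by (rule order_trans)
  show ?thesis
  proof (intro conjI exI[of _ C] allI impI)
    fix n :: nat assume "odd n \<and> n \<ge> 3"
    then have "odd n" by simp
    then show "\<bar>fib_frac_sum n - (pi / 8 * real n
        + 1 / 4 * (circle_error (real n) - circle_error (real n / 2)))\<bar> \<le> C * real n powr \<epsilon>"
      using err[of n] by (simp only: card_odd_exponent_odd[OF \<open>odd n\<close>] odd_main_term)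
  next
    fix n :: nat assume n: "even n \<and> n \<ge> 4"
    then have "even n" "n > 0" by simp_all
    then show "\<bar>fib_frac_sum n - (3 * ln 2 / 4 * real n + 2 * hyperbola_error (real n / 2)
        - 5 * hyperbola_error (real n / 4) + 2 * hyperbola_error (real n / 8))\<bar> \<le> C * real n powr \<epsilon>"
      using err[of n] by (simp only: card_odd_exponent_even[OF \<open>even n\<close>] even_main_term[OF \<open>n > 0\<close>])
  qed
qed

end
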